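(* Let $G$ be a finite, simple, connected graph with at least one edge, on vertex set $\{1,\dots,N\}$, let $n=N-1$, and let $\nabla_G=\{\pm(\mathbf e_i-\mathbf e_j)\mid \{i,j\}\in\mathcal E(G)\}\subset\mathbb R^N$. Let $B$ be a maximal bipartite subgraph of $G$ with vertex bipartition $\mathcal V(B)=V_+\cup V_-$, let $T$ be a spanning tree of $B$, and let $\vec T$ be the canonical orientation of $T$, in which every edge is directed from its endpoint in $V_-$ to its endpoint in $V_+$. Fix an ordering $t_1,\dots,t_n$ of the directed edges of $\vec T$. For each edge $e\in\mathcal E(G)\setminus\mathcal E(T)$, let $\mathbf c_{\vec T}(e)\in\{-1,0,1\}^n$ be the vector of the fundamental cycle of $e$ with respect to $T$, equipped with a chosen coherent orientation: its $k$-th entry is $+1$ if the oriented cycle traverses $t_k$ in the direction of $t_k$, $-1$ if it traverses $t_k$ in the opposite direction, and $0$ if $t_k$ is not on the cycle. Then there is a bijection between the set $\{F\mid F\text{ a facet of }\nabla_G,\ G_F=B\}$ and the set of vectors $\mathbf d\in\{\pm1\}^n$ (cut-set sign vectors of $T$ with respect to the cut $(V_+,V_-)$) satisfying $$\mathbf c_{\vec T}(e)^\top\mathbf d=\pm1\ \text{ for all } e\in\mathcal E(B)\setminus\mathcal E(T),\qquad \mathbf c_{\vec T}(e)^\top\mathbf d=0\ \text{ for all } e\in\mathcal E(G)\setminus\mathcal E(B).$$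
   Context: $\mathbf e_1,\dots,\mathbf e_N$ is the standard basis of $\mathbb R^N$. A subset $F\subseteq\nabla_G$ is a facet of $\nabla_G$ if $F=\nabla_G\cap P'$ for a facet $P'$ of the polytope $\operatorname{conv}(\nabla_G)$. $G_F$ is the undirected graph whose edges are the $\{i,j\}$ with $\mathbf e_i-\mathbf e_j\in F$ or $\mathbf e_j-\mathbf e_i\in F$ (vertices: their endpoints). A maximal bipartite subgraph of $G$ is a bipartite subgraph maximal under inclusion; it is spanning and connected, so $T$ is also a spanning tree of $G$. The fundamental cycle of $e\notin\mathcal E(T)$ is the unique cycle formed by $e$ and the path in $T$ joining its endpoints. A vector $\mathbf d\in\{\pm1\}^n$ is viewed as assigning to each edge $t_k$ of $T$ (all of which cross the cut $(V_+,V_-)$) a direction across the cut (same as or opposite to $t_k$); the sign ambiguity $\pm1$ reflects the arbitrary choice of orientation of each fundamental cycle. *)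

theory Defs
  imports "HOL-Analysis.Analysis" "Graph_Theory.Digraph_Component"
begin

text \<open>
  A finite simple undirected graph is a \<^locale>\<open>pair_graph\<close>: a loop-free digraph without
  parallel arcs in which both \<open>(u, v)\<close> and \<open>(v, u)\<close> are arcs for every undirected edge \<open>{u, v}\<close>.
\<close>

definition uedges :: "'a pair_pre_digraph \<Rightarrow> 'a set set" where
  "uedges H = {{u, v} | u v. (u, v) \<in> parcs H}"

definition bipartition :: "('a, 'b) pre_digraph \<Rightarrow> 'a set \<Rightarrow> 'a set \<Rightarrow> bool" where
  "bipartition H Vp Vm \<longleftrightarrow>
     verts H = Vp \<union> Vm \<and> Vp \<inter> Vm = {} \<and>
     (\<forall>(u, v) \<in> arcs_ends H. u \<in> Vp \<and> v \<in> Vm \<or> u \<in> Vm \<and> v \<in> Vp)"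

definition bipartite_graph :: "('a, 'b) pre_digraph \<Rightarrow> bool" where
  "bipartite_graph H \<longleftrightarrow> graph H \<and> (\<exists>Vp Vm. bipartition H Vp Vm)"

definition max_bipartite_subgraph :: "'a pair_pre_digraph \<Rightarrow> 'a pair_pre_digraph \<Rightarrow> bool" where
  "max_bipartite_subgraph G B \<longleftrightarrow>
     pre_digraph.max_subgraph (with_proj G) bipartite_graph (with_proj B)"

text \<open>
  The library's \<^const>\<open>forest\<close> and \<^const>\<open>tree\<close> do not fit symmetric digraphs, since
  \<open>u, v, u\<close> counts as a cycle there; undirected cycles are those of length at least three.
\<close>

definition undirected_tree :: "'a pair_pre_digraph \<Rightarrow> bool" where
  "undirected_tree T \<longleftrightarrow>
     pair_graph T \<and> Digraph_Component.connected (with_proj T) \<and>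
     \<not> (\<exists>p. pre_digraph.cycle (with_proj T) p \<and> 3 \<le> length p)"

definition undirected_spanning_tree :: "'a pair_pre_digraph \<Rightarrow> 'a pair_pre_digraph \<Rightarrow> bool" where
  "undirected_spanning_tree T H \<longleftrightarrow>
     undirected_tree T \<and> spanning (with_proj T) (with_proj H)"

definition canonical_orientation :: "'a pair_pre_digraph \<Rightarrow> 'a set \<Rightarrow> 'a set \<Rightarrow> ('a \<times> 'a) set" where
  "canonical_orientation T Vp Vm = {(u, v) \<in> parcs T. u \<in> Vm \<and> v \<in> Vp}"

text \<open>
  A coherently oriented fundamental cycle is listed by its arcs, starting with \<open>e\<close> itself.
  The two choices of the arc \<open>(u, v)\<close> with \<open>e = {u, v}\<close> are the two orientations of the cycle.
\<close>

definition oriented_fundamental_cycle ::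
  "'a pair_pre_digraph \<Rightarrow> 'a set \<Rightarrow> ('a \<times> 'a) list \<Rightarrow> bool" where
  "oriented_fundamental_cycle T e p \<longleftrightarrow>
     (\<exists>u v q. e = {u, v} \<and> pre_digraph.apath (with_proj T) v q u \<and> p = (u, v) # q)"

definition traversal_sign :: "('a \<times> 'a) list \<Rightarrow> 'a \<times> 'a \<Rightarrow> int" where
  "traversal_sign p a =
     (if a \<in> set p then 1 else if (snd a, fst a) \<in> set p then - 1 else 0)"

definition nabla :: "'v::finite pair_pre_digraph \<Rightarrow> (real ^ 'v) set" where
  "nabla G = {x. \<exists>i j. {i, j} \<in> uedges G \<and>
     (x = axis i 1 - axis j 1 \<or> x = - (axis i 1 - axis j 1))}"

definition nabla_facet :: "'v::finite pair_pre_digraph \<Rightarrow> (real ^ 'v) set \<Rightarrow> bool" where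
  "nabla_facet G F \<longleftrightarrow> (\<exists>P. P facet_of (convex hull (nabla G)) \<and> F = nabla G \<inter> P)"

definition facet_graph :: "(real ^ 'v::finite) set \<Rightarrow> 'v pair_pre_digraph" where
  "facet_graph F =
     (let A = {(i, j). i \<noteq> j \<and> (axis i 1 - axis j 1 \<in> F \<or> axis j 1 - axis i 1 \<in> F)}
      in \<lparr> pverts = Field A, parcs = A \<rparr>)"

end

theory Submission
  imports Defs
begin

text \<open>
  A facet of \<open>conv \<nabla>\<^sub>G\<close> is cut out by \<open>h \<bullet> x = 1\<close> for a potential \<open>h\<close> on the vertices with
  \<open>\<bar>h i - h j\<bar> \<le> 1\<close> on every edge of \<open>G\<close>, and \<open>G\<^sub>F\<close> consists of the edges where equality holds.
  If \<open>G\<^sub>F = B\<close>, then connectedness of \<open>B\<close> makes \<open>h\<close> integral after normalising it to vanish at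
  a root, so \<open>h\<close> is constant along the edges of \<open>G\<close> outside \<open>B\<close>. Conversely, the level set of
  such an integral potential spans the same linear space as \<open>\<nabla>\<^sub>G\<close> and hence gives a facet.
  Finally, an integral potential is determined by its differences \<open>d\<close> along the edges of \<open>T\<close>,
  which are arbitrary; telescoping along a fundamental cycle identifies \<open>c(e)\<^sup>T d\<close> with the
  difference of \<open>h\<close> along \<open>e\<close>, up to sign.
\<close>

section \<open>Potentials on connected graphs and trees\<close>

lemma pcas_sum_diff:
  fixes h :: "'a \<Rightarrow> 'b::ab_group_add"
  assumes "pcas u p v"
  shows "(\<Sum>(x, y)\<leftarrow>p. h y - h x) = h v - h u"
  using assms by (induct u p v rule: pcas.induct) auto

text \<open>Arcs come in opposite pairs, so connectedness yields a directed walk from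
  \<open>u\<close> to \<open>v\<close>, along which \<open>P\<close> is carried.\<close>

lemma (in pair_graph) connected_propagate [consumes 3, case_names base step]:
  assumes "Digraph_Component.connected (with_proj G)"
    and "u \<in> pverts G" "v \<in> pverts G"
    and "P u"
    and step: "\<And>x y. (x, y) \<in> parcs G \<Longrightarrow> P x \<Longrightarrow> P y"
  shows "P v"
proof -
  have "strongly_connected (with_proj G)"
    using symmetric_connected_imp_strongly_connected[OF sym_arcs assms(1)] .
  then have "u \<rightarrow>\<^sup>*\<^bsub>with_proj G\<^esub> v"
    using assms(2,3) by auto
  then show ?thesis
    by (induct rule: reachable_induct) (use assms(4) step in auto)
qed

lemma (in pair_graph) potential_determined:
  fixes h h' :: "'a \<Rightarrow> 'b::ab_group_add"
  assumes "Digraph_Component.connected (with_proj G)"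
    and "r \<in> pverts G" "v \<in> pverts G" "h r = h' r"
    and "\<And>x y. (x, y) \<in> parcs G \<Longrightarrow> h y - h x = h' y - h' x"
  shows "h v = h' v"
  using assms(1-3)
proof (induct rule: connected_propagate)
  case base
  show ?case by fact
next
  case (step x y)
  then show ?case using assms(5)[of x y] by simp
qed

text \<open>Induction on length: a closed walk with a repeated vertex splits into two shorter ones;
  otherwise it is a cycle, which here can only go along an arc and back, and the two weights
  cancel.\<close>

lemma (in pair_graph) tree_closed_walk_sum:
  fixes w :: "'a \<times> 'a \<Rightarrow> 'b::ab_group_add"
  assumes tree: "\<not> (\<exists>p. cycle p \<and> 3 \<le> length p)"
    and anti: "\<And>x y. (x, y) \<in> parcs G \<Longrightarrow> w (y, x) = - w (x, y)"
    and "awalk u p u"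
  shows "sum_list (map w p) = 0"
  using assms(3)
proof (induct "length p" arbitrary: u p rule: less_induct)
  case less
  show ?case
  proof (cases p)
    case Nil
    then show ?thesis by simp
  next
    case (Cons e es)
    then have e: "e \<in> parcs G" "fst e = u" and es: "awalk (snd e) es u"
      using less.prems by (auto simp: awalk_Cons_iff)
    \<comment> \<open>The start \<open>u\<close> is left out of this vertex list because it recurs
      as the endpoint; distinctness is then what \<open>cycle\<close> demands.\<close>
    show ?thesis
    proof (cases "distinct (awalk_verts (snd e) es)")
      case True
      then have "cycle p"
        using less.prems Cons by (auto simp: cycle_def)
      then have short: "\<not> 3 \<le> length p" "2 \<le> length p"
        using tree cycle_digraph_conv by auto
      then obtain e' where es_eq: "es = [e']"
        using Cons by (cases es) (auto simp: Suc_le_eq)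
      then have "e' = (snd e, u)"
        using es by (cases e') (auto simp: awalk_Cons_iff awalk_Nil_iff)
      then show ?thesis
        using Cons es_eq anti[of u "snd e"] e by (cases e) auto
    next
      case False
      obtain q s1 s2 x where dec: "es = q @ s1 @ s2" "s1 \<noteq> []"
        "awalk (snd e) q x" "awalk x s1 x" "awalk x s2 u"
        using awalk_not_distinct_decomp[OF es False] by auto
      have "awalk u (e # q @ s2) u"
        using dec e by (cases e) (auto simp: awalk_Cons_iff dest: in_arcsD1)
      then have "sum_list (map w (e # q @ s2)) = 0"
        using less.hyps[of "e # q @ s2" u] dec Cons by simp
      moreover have "sum_list (map w s1) = 0"
        using less.hyps[of s1 x] dec Cons by simp
      ultimately show ?thesis
        using Cons dec by (simp add: algebra_simps)
    qed
  qed
qed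

text \<open>\<open>h v\<close> sums the weights along a chosen walk from \<open>r\<close> to
  \<open>v\<close>. The choice is harmless: out to \<open>x\<close>, across to \<open>y\<close> and
  back along a reversed walk is closed, so its weights sum to zero.\<close>

lemma (in pair_graph) tree_potential_exists:
  fixes w :: "'a \<times> 'a \<Rightarrow> 'b::ab_group_add"
  assumes tree: "undirected_tree G"
    and r: "r \<in> pverts G"
    and anti: "\<And>x y. (x, y) \<in> parcs G \<Longrightarrow> w (y, x) = - w (x, y)"
  obtains h where "h r = 0" "\<And>x y. (x, y) \<in> parcs G \<Longrightarrow> h y - h x = w (x, y)"
proof -
  have conn: "Digraph_Component.connected (with_proj G)"
    and acyc: "\<not> (\<exists>p. cycle p \<and> 3 \<le> length p)"
    using tree by (auto simp: undirected_tree_def)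
  have closed: "sum_list (map w p) = 0" if "awalk u p u" for u p
    using tree_closed_walk_sum[OF acyc _ that] anti by blast
  have rev_sum: "sum_list (map w (rev_path p)) = - sum_list (map w p)" if "set p \<subseteq> parcs G" for p
    using that by (induct p) (auto simp: anti)
  have "\<exists>p. awalk r p v" if "v \<in> pverts G" for v
    using symmetric_connected_imp_strongly_connected[OF sym_arcs conn] r that reachable_awalk
    by auto
  then obtain p where p: "\<And>v. v \<in> pverts G \<Longrightarrow> awalk r (p v) v"
    by metis
  define h where "h v = sum_list (map w (p v))" for v
  show thesis
  proof
    show "h r = 0"
      unfolding h_def using closed p[OF r] by blast
    fix x y assume xy: "(x, y) \<in> parcs G"
    then have x: "x \<in> pverts G" and y: "y \<in> pverts G"
      by (auto dest: in_arcsD1 in_arcsD2)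
    have "awalk y (rev_path (p y)) r"
      using p[OF y] by simp
    then have "awalk r (p x @ (x, y) # rev_path (p y)) r"
      using p[OF x] xy x by (auto simp: awalk_Cons_iff)
    then have "sum_list (map w (p x @ (x, y) # rev_path (p y))) = 0"
      by (rule closed)
    moreover have "set (p y) \<subseteq> parcs G"
      using p[OF y] by auto
    ultimately show "h y - h x = w (x, y)"
      unfolding h_def by (simp add: rev_sum algebra_simps)
  qed
qed

section \<open>The vectors \<open>e\<^sub>i - e\<^sub>j\<close>\<close>

text \<open>Coordinates \<open>i\<close> and \<open>j\<close> identify the pair. The hypothesis
  excludes the zero vector, which every vertex would represent.\<close>

lemma axis_diff_inject:
  fixes i j k l :: "'v::finite"
  assumes "i \<noteq> j"
  shows "axis i 1 - axis j 1 = (axis k 1 - axis l 1 :: real ^ 'v) \<longleftrightarrow> i = k \<and> j = l"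
proof
  assume "axis i 1 - axis j 1 = (axis k 1 - axis l 1 :: real ^ 'v)"
  then have eq: "axis i 1 $ m - axis j 1 $ m = (axis k 1 $ m - axis l 1 $ m :: real)" for m
    by (metis vector_minus_component)
  show "i = k \<and> j = l"
    using eq[of i] eq[of j] assms by (auto simp: axis_def split: if_splits)
qed auto

lemma inner_axis_diff:
  fixes a :: "real ^ 'v::finite"
  shows "a \<bullet> (axis i 1 - axis j 1) = a $ i - a $ j"
  by (simp add: inner_diff_right inner_axis)

lemma (in pair_graph) uedges_iff: "{i, j} \<in> uedges G \<longleftrightarrow> (i, j) \<in> parcs G"
  by (auto simp: uedges_def doubleton_eq_iff dest: arcs_symmetric)

lemma nabla_eq:
  fixes G :: "'v::finite pair_pre_digraph"
  assumes "pair_graph G"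
  shows "nabla G = {axis i 1 - axis j 1 | i j. (i, j) \<in> parcs G}"
proof -
  interpret pair_graph G by fact
  show ?thesis
    unfolding nabla_def uedges_iff minus_diff_eq by (blast dest: arcs_symmetric)
qed

lemma uminus_nabla: "x \<in> nabla G \<Longrightarrow> - x \<in> nabla G"
  unfolding nabla_def mem_Collect_eq by (metis minus_minus)

lemma finite_nabla: "finite (nabla G)"
proof -
  have "nabla G \<subseteq> (\<lambda>(i, j). axis i 1 - axis j 1) ` UNIV \<union> (\<lambda>(i, j). - (axis i 1 - axis j 1)) ` UNIV"
    unfolding nabla_def by auto
  then show ?thesis by (rule finite_subset) simp
qed

lemma convex_hull_inner_le:
  assumes "\<And>x. x \<in> S \<Longrightarrow> a \<bullet> x \<le> b" "x \<in> convex hull S"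
  shows "a \<bullet> x \<le> (b::real)"
  using hull_minimal[of S "{x. a \<bullet> x \<le> b}" convex] assms convex_halfspace_le[of a b] by blast

text \<open>The facet proposed for \<open>h\<close>: the points of \<open>nabla G\<close> where the
  functional with coefficients \<open>h\<close> equals 1.\<close>

definition level_set :: "'v::finite pair_pre_digraph \<Rightarrow> ('v \<Rightarrow> int) \<Rightarrow> (real ^ 'v) set" where
  "level_set G h = {axis i 1 - axis j 1 | i j. (i, j) \<in> parcs G \<and> h i - h j = 1}"

text \<open>The intermediate set between facets and sign vectors. Adding a constant to
  \<open>h\<close> does not change the functional on \<open>nabla G\<close>; fixing the value at the
  root \<open>r\<close> removes this freedom.\<close>

definition potentials ::
  "'v pair_pre_digraph \<Rightarrow> 'v pair_pre_digraph \<Rightarrow> 'v \<Rightarrow> ('v \<Rightarrow> int) set" where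
  "potentials G B r = {h. h r = 0 \<and> (\<forall>(i, j) \<in> parcs B. \<bar>h i - h j\<bar> = 1) \<and>
     (\<forall>(i, j) \<in> parcs G - parcs B. h i = h j)}"

lemma axis_diff_in_level_set_iff:
  fixes G :: "'v::finite pair_pre_digraph"
  assumes "pair_graph G"
  shows "axis i 1 - axis j 1 \<in> level_set G h \<longleftrightarrow> (i, j) \<in> parcs G \<and> h i - h j = 1"
proof (cases "i = j")
  case True
  interpret pair_graph G by fact
  have False if "(k, l) \<in> parcs G" "0 = (axis k 1 - axis l 1 :: real ^ 'v)" for k l
  proof -
    have "k \<noteq> l" using that no_loops' by blast
    then show False using that axis_diff_inject[of k l k k] by simp
  qed
  then show ?thesis using True by (auto simp: level_set_def)
next
  case False
  then show ?thesis
    using axis_diff_inject[OF False] by (auto simp: level_set_def)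
qed

section \<open>Facets as potentials\<close>

context
  fixes G B :: "'v::finite pair_pre_digraph" and r :: 'v
  assumes G: "pair_graph G" and B: "pair_graph B"
    and verts_B: "pverts B = UNIV"
    and conn_B: "Digraph_Component.connected (with_proj B)"
    and sub: "parcs B \<subseteq> parcs G"
    and ne: "parcs B \<noteq> {}"
begin

interpretation G: pair_graph G by (rule G)
interpretation B: pair_graph B by (rule B)

text \<open>\<open>facet_graph\<close> keeps only endpoints of edges as vertices, so identifying it
  with \<open>B\<close> requires that \<open>B\<close> has no isolated vertex.\<close>

lemma Field_B: "Field (parcs B) = UNIV"
proof -
  obtain i j where ij: "(i, j) \<in> parcs B" using ne by auto
  have "v \<in> Field (parcs B)" for v
    using conn_B UNIV_I[of i] UNIV_I[of v] unfolding verts_B[symmetric]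
    by (induct rule: B.connected_propagate) (use ij in \<open>auto simp: Field_def\<close>)
  then show ?thesis by auto
qed

text \<open>The supporting hyperplane of value 1 gives a face; a dimension count shows that at most
  one dimension is lost, and central symmetry that at least one is.\<close>

lemma level_set_is_facet:
  assumes h: "h \<in> potentials G B r"
  shows "nabla_facet G (level_set G h)" "facet_graph (level_set G h) = B"
proof -
  let ?F = "level_set G h" and ?Q = "convex hull nabla G"
  define a :: "real ^ 'v" where "a = (\<chi> i. of_int (h i))"
  define P where "P = ?Q \<inter> {x. a \<bullet> x = 1}"
  have a: "a \<bullet> (axis i 1 - axis j 1) = of_int (h i - h j)" for i j
    by (simp add: inner_axis_diff a_def)
  have arcB: "\<bar>h i - h j\<bar> = 1" if "(i, j) \<in> parcs B" for i j
    using h that by (auto simp: potentials_def)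
  have arcG: "h i = h j" if "(i, j) \<in> parcs G" "(i, j) \<notin> parcs B" for i j
    using h that by (auto simp: potentials_def)
  have F_eq: "?F = nabla G \<inter> {x. a \<bullet> x = 1}"
    unfolding level_set_def nabla_eq[OF G] using a by (auto; metis of_int_1 of_int_eq_iff)
  then have F_P: "?F = nabla G \<inter> P" and "?F \<subseteq> P"
    unfolding P_def by (auto intro: hull_inc)
  have "a \<bullet> x \<le> 1" if "x \<in> nabla G" for x
  proof -
    obtain i j where ij: "(i, j) \<in> parcs G" "x = axis i 1 - axis j 1"
      using \<open>x \<in> nabla G\<close> by (auto simp: nabla_eq[OF G])
    have "h i - h j \<le> 1"
      using arcB[of i j] arcG[of i j] ij(1) by linarith
    then show ?thesis
      unfolding ij(2) a by simp
  qed
  then have le: "a \<bullet> x \<le> 1" if "x \<in> ?Q" for x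
    using convex_hull_inner_le that by blast
  have face: "P face_of ?Q"
    unfolding P_def using le by (intro face_of_Int_supporting_hyperplane_le) auto

  have up: "axis i 1 - axis j 1 \<in> ?F \<or> axis j 1 - axis i 1 \<in> ?F" if "(i, j) \<in> parcs B" for i j
    using arcB[OF that] that sub B.arcs_symmetric
    by (auto simp: axis_diff_in_level_set_iff[OF G] abs_if split: if_splits)
  obtain i j where ij: "(i, j) \<in> parcs B" using ne by auto
  obtain x where x: "x \<in> ?F" using up[OF ij] by blast
  have span_B: "axis i 1 - axis j 1 \<in> span ?F" if "(i, j) \<in> parcs B" for i j
    using up[OF that] span_base[of "axis i 1 - axis j 1" ?F]
      span_neg[OF span_base[of "axis j 1 - axis i 1" ?F]] by auto
  \<comment> \<open>Telescoping along walks in \<open>B\<close> reaches any pair of vertices, hence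
    also the edges of \<open>G\<close> outside \<open>B\<close>.\<close>
  have span_all: "axis i 1 - axis j 1 \<in> span ?F" for i j
    using conn_B UNIV_I[of j] UNIV_I[of i] unfolding verts_B[symmetric]
  proof (induct rule: B.connected_propagate)
    case base
    show ?case by (simp add: span_zero)
  next
    case (step k l)
    then have "(axis l 1 - axis k 1) + (axis k 1 - axis j 1) \<in> span ?F"
      using span_add[OF span_B[OF B.arcs_symmetric[OF step(1)]] step(2)] by simp
    then show ?case by simp
  qed
  have "nabla G \<subseteq> span ?F"
    unfolding nabla_eq[OF G] using span_all by auto
  then have "?Q \<subseteq> span ?F"
    by (intro hull_minimal) (auto simp: subspace_imp_convex)
  \<comment> \<open>Affine and linear dimension agree once the origin is adjoined, and adjoining one
    point adds at most one dimension.\<close>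
  then have "aff_dim ?Q \<le> aff_dim (span ?F)"
    by (rule aff_dim_subset)
  also have "\<dots> = int (dim (insert 0 ?F))"
    by (simp add: aff_dim_subspace dim_insert span_zero)
  also have "\<dots> = aff_dim (insert 0 ?F)"
    by (rule aff_dim_zero[symmetric]) (simp add: hull_inc)
  also have "\<dots> \<le> aff_dim ?F + 1"
    by (simp add: aff_dim_insert)
  also have "\<dots> \<le> aff_dim P + 1"
    using \<open>?F \<subseteq> P\<close> by (simp add: aff_dim_subset)
  finally have ge: "aff_dim ?Q \<le> aff_dim P + 1" .
  \<comment> \<open>The antipode of a point of \<open>?F\<close> has value -1, so the face is
    proper.\<close>
  have "- x \<in> ?Q"
    using x F_eq uminus_nabla by (auto intro: hull_inc)
  moreover have "- x \<notin> P"
    using x F_eq by (auto simp: P_def)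
  ultimately have "P \<noteq> ?Q" by auto
  then have "aff_dim P < aff_dim ?Q"
    using face by (intro face_of_aff_dim_lt) auto
  then have "P facet_of ?Q"
    using ge face x \<open>?F \<subseteq> P\<close> by (auto simp: facet_of_def)
  then show "nabla_facet G ?F"
    unfolding nabla_facet_def using F_P by blast
  have "{(i, j). i \<noteq> j \<and> (axis i 1 - axis j 1 \<in> ?F \<or> axis j 1 - axis i 1 \<in> ?F)} = parcs B"
  proof -
    have "(i, j) \<in> parcs B" if "axis i 1 - axis j 1 \<in> ?F" for i j
      using that arcG[of i j] by (auto simp: axis_diff_in_level_set_iff[OF G])
    then show ?thesis
      using up B.no_loops' B.arcs_symmetric by blast
  qed
  then show "facet_graph ?F = B"
    by (simp add: facet_graph_def Field_B verts_B[symmetric])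
qed

text \<open>Rescaling an exposing functional by its maximum and shifting by its value at
  \<open>r\<close> gives a potential, integral because \<open>B\<close> is connected.\<close>

lemma facet_is_level_set:
  assumes "nabla_facet G F" "facet_graph F = B"
  obtains h where "h \<in> potentials G B r" "F = level_set G h"
proof -
  let ?Q = "convex hull nabla G"
  obtain P where P: "P facet_of ?Q" "F = nabla G \<inter> P"
    using assms(1) by (auto simp: nabla_facet_def)
  have "P face_of ?Q" "P \<noteq> ?Q" "P \<noteq> {}"
    using P(1) by (auto simp: facet_of_def)
  moreover have "polyhedron ?Q"
    by (simp add: finite_nabla polytope_convex_hull polytope_imp_polyhedron)
  \<comment> \<open>Every face of a polyhedron is exposed; nonemptiness and properness rule out the
    degenerate cases, in which no hyperplane is provided.\<close>
  ultimately obtain a b where ab: "?Q \<subseteq> {x. a \<bullet> x \<le> b}" "P = ?Q \<inter> {x. a \<bullet> x = b}"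
    using exposed_face_of_polyhedron[of ?Q P] exposed_face_of[of P ?Q] by auto
  have nab: "a \<bullet> x \<le> b" if "x \<in> nabla G" for x
    using that ab(1) hull_subset[of "nabla G" convex] by blast
  \<comment> \<open>By the symmetry of \<open>nabla G\<close>, \<open>b \<le> 0\<close> would force \<open>P\<close> to be the whole polytope.\<close>
  have "b > 0"
  proof (rule ccontr)
    assume "\<not> b > 0"
    then have "a \<bullet> x = 0 \<and> b = 0" if "x \<in> nabla G" for x
      using nab[OF that] nab[OF uminus_nabla[OF that]] by auto
    moreover obtain x0 where "x0 \<in> nabla G"
      using \<open>P \<noteq> {}\<close> ab(2) by (metis Int_empty_left convex_hull_empty ex_in_conv)
    ultimately have "nabla G \<subseteq> {x. a \<bullet> x = b}" by auto
    then have "?Q \<subseteq> {x. a \<bullet> x = b}"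
      by (intro hull_minimal) (auto simp: convex_hyperplane)
    then show False using \<open>P \<noteq> ?Q\<close> ab(2) by auto
  qed
  define g where "g i = (a $ i - a $ r) / b" for i
  have g: "g i - g j = (a \<bullet> (axis i 1 - axis j 1)) / b" for i j
    by (simp add: g_def inner_axis_diff diff_divide_distrib)
  have in_F: "axis i 1 - axis j 1 \<in> F \<longleftrightarrow> g i - g j = 1" if "(i, j) \<in> parcs G" for i j
  proof -
    have "axis i 1 - axis j 1 \<in> nabla G"
      using that by (auto simp: nabla_eq[OF G])
    then show ?thesis
      using \<open>b > 0\<close> by (auto simp: P(2) ab(2) g hull_inc)
  qed
  have g_le: "g i - g j \<le> 1" if "(i, j) \<in> parcs G" for i j
  proof -
    have "axis i 1 - axis j 1 \<in> nabla G"
      using that by (auto simp: nabla_eq[OF G])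
    then show ?thesis
      using nab \<open>b > 0\<close> by (simp add: g)
  qed
  have parcs_B: "parcs B = {(i, j). i \<noteq> j \<and> (axis i 1 - axis j 1 \<in> F \<or> axis j 1 - axis i 1 \<in> F)}"
    using assms(2) by (auto simp: facet_graph_def Let_def)
  have B_diff: "g i - g j = 1 \<or> g j - g i = 1" if "(i, j) \<in> parcs B" for i j
    using that in_F[of i j] in_F[of j i] sub B.arcs_symmetric[OF that] parcs_B by blast
  have "g v \<in> \<int>" for v
    using conn_B UNIV_I[of r] UNIV_I[of v] unfolding verts_B[symmetric]
  proof (induct rule: B.connected_propagate)
    case base
    show ?case by (simp add: g_def)
  next
    case (step x y)
    have "g y = g x + 1 \<or> g y = g x - 1"
      using B_diff[OF step(1)] by auto
    then show ?case using step(2) by auto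
  qed
  then have "\<exists>z. g v = of_int z" for v
    by (auto elim: Ints_cases)
  then obtain h :: "'v \<Rightarrow> int" where h: "\<And>v. g v = of_int (h v)"
    by metis
  have h_diff: "g i - g j = 1 \<longleftrightarrow> h i - h j = 1" for i j
    unfolding h by (metis of_int_1 of_int_diff of_int_eq_iff)
  have h_le: "h i - h j \<le> 1" if "(i, j) \<in> parcs G" for i j
    using g_le[OF that] unfolding h by linarith
  show thesis
  proof
    have "h r = 0"
      using h[of r] by (simp add: g_def)
    moreover have "\<bar>h i - h j\<bar> = 1" if "(i, j) \<in> parcs B" for i j
      using B_diff[OF that] unfolding h_diff by auto
    \<comment> \<open>Integrality enters here: the difference is at most 1 in both directions and
      never equal to 1, so it lies strictly between -1 and 1.\<close>
    moreover have "h i = h j" if "(i, j) \<in> parcs G" "(i, j) \<notin> parcs B" for i j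
    proof -
      have ji: "(j, i) \<in> parcs G" and "i \<noteq> j"
        using that G.arcs_symmetric G.no_loops' by auto
      then have "h i - h j \<noteq> 1" "h j - h i \<noteq> 1"
        using that in_F[OF that(1)] in_F[OF ji] parcs_B unfolding h_diff by auto
      then show ?thesis using h_le[OF that(1)] h_le[OF ji] by linarith
    qed
    ultimately show "h \<in> potentials G B r"
      by (auto simp: potentials_def)
    have "F \<subseteq> nabla G" using P(2) by auto
    then show "F = level_set G h"
      using in_F unfolding level_set_def nabla_eq[OF G] h_diff by blast
  qed
qed

text \<open>For injectivity, the level set records in which direction \<open>h\<close> drops along
  each edge of \<open>B\<close>, hence all differences along \<open>B\<close>, and these fix
  \<open>h\<close> from its value at \<open>r\<close>.\<close>

lemma bij_betw_level_set:
  "bij_betw (level_set G) (potentials G B r) {F. nabla_facet G F \<and> facet_graph F = B}"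
proof (rule bij_betwI')
  fix h h' assume h: "h \<in> potentials G B r" "h' \<in> potentials G B r"
  show "level_set G h = level_set G h' \<longleftrightarrow> h = h'"
  proof
    assume eq: "level_set G h = level_set G h'"
    have iff: "h i - h j = 1 \<longleftrightarrow> h' i - h' j = 1" if "(i, j) \<in> parcs B" for i j
      using eq that sub axis_diff_in_level_set_iff[OF G] by blast
    have "h y - h x = h' y - h' x" if "(x, y) \<in> parcs B" for x y
    proof -
      have "\<bar>h x - h y\<bar> = 1" "\<bar>h' x - h' y\<bar> = 1"
        using h that by (auto simp: potentials_def)
      then show ?thesis
        using iff[OF that] iff[OF B.arcs_symmetric[OF that]] by linarith
    qed
    moreover have "h r = h' r"
      using h by (simp add: potentials_def)
    ultimately have "h v = h' v" for v
      using B.potential_determined[OF conn_B, of r v h h'] verts_B by auto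
    then show "h = h'" by auto
  qed auto
next
  fix h assume "h \<in> potentials G B r"
  then show "level_set G h \<in> {F. nabla_facet G F \<and> facet_graph F = B}"
    using level_set_is_facet by auto
next
  fix F assume "F \<in> {F. nabla_facet G F \<and> facet_graph F = B}"
  then show "\<exists>h \<in> potentials G B r. F = level_set G h"
    using facet_is_level_set by auto
qed

end

section \<open>Potentials as sign vectors\<close>

text \<open>If the reverse of the first arc occurred later, the path would return to its start.
  Hence the two nonzero cases of \<open>traversal_sign\<close> exclude each other on a path.\<close>

lemma (in pair_graph) apath_no_reversed_arc:
  assumes "apath u p v" "(x, y) \<in> set p"
  shows "(y, x) \<notin> set p"
  using assms
proof (induct p arbitrary: u)
  case (Cons e es)
  then have e: "e \<in> parcs G" "apath (snd e) es v" "fst e \<notin> set (awalk_verts (snd e) es)"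
    by (auto simp: apath_Cons_iff)
  then have walk: "awalk (snd e) es v"
    by (auto simp: apath_def)
  have "(snd e, fst e) \<notin> set es"
    using awalk_verts_arc2[OF walk] e(3) by fastforce
  moreover have "(snd e, fst e) \<noteq> e"
    using no_loops e(1) by (metis fst_conv)
  ultimately show ?case
    using Cons.hyps[OF e(2)] Cons.prems(2) by auto
qed simp

text \<open>Splitting each term into an arc and its reverse turns the signed sum over
  \<open>C\<close> into a sum over the arcs of \<open>q\<close>, which telescopes from
  \<open>v\<close> to \<open>u\<close>.\<close>

lemma (in pair_graph) fundamental_cycle_sum:
  fixes h :: "'a \<Rightarrow> int"
  assumes path: "apath v q u" and new: "(u, v) \<notin> parcs G"
    and C: "parcs G = C \<union> prod.swap ` C" "C \<inter> prod.swap ` C = {}"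
    and t: "bij_betw t {1..n} C"
  shows "(\<Sum>k = 1..n. traversal_sign ((u, v) # q) (t k) * (h (snd (t k)) - h (fst (t k)))) = h u - h v"
proof -
  \<comment> \<open>Traversing an arc \<open>a\<close> of \<open>C\<close> backwards is counted by
    \<open>f (prod.swap a)\<close>, whose value already carries the minus sign.\<close>
  define f where "f a = (if a \<in> set q then h (snd a) - h (fst a) else 0)" for a
  have walk: "awalk v q u" and "distinct q"
    using path distinct_verts_imp_distinct by (auto simp: apath_def)
  then have q: "set q \<subseteq> parcs G" "pcas v q u"
    by (auto simp: awalk_def)
  have fin: "finite C"
    using C(1) pair_finite_arcs by auto
  have sign: "traversal_sign ((u, v) # q) a * (h (snd a) - h (fst a)) = f a + f (prod.swap a)"
    if "a \<in> C" for a
  proof (cases a)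
    case (Pair x y)
    have "(x, y) \<in> parcs G"
      using that Pair C(1) by auto
    \<comment> \<open>The closing arc heads the list seen by \<open>traversal_sign\<close>; it must
      not be mistaken for an arc of \<open>C\<close> or its reverse.\<close>
    then have neq: "(x, y) \<noteq> (u, v)" "(y, x) \<noteq> (u, v)"
      using new arcs_symmetric by blast+
    have "\<not> ((x, y) \<in> set q \<and> (y, x) \<in> set q)"
      using apath_no_reversed_arc[OF path] by blast
    then show ?thesis
      using neq by (cases "(x, y) \<in> set q"; cases "(y, x) \<in> set q")
        (simp_all add: Pair traversal_sign_def f_def del: prod.inject)
  qed
  have "(\<Sum>k = 1..n. traversal_sign ((u, v) # q) (t k) * (h (snd (t k)) - h (fst (t k))))
      = (\<Sum>a\<in>C. traversal_sign ((u, v) # q) a * (h (snd a) - h (fst a)))"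
    using sum.reindex_bij_betw[OF t, of "\<lambda>a. traversal_sign ((u, v) # q) a * (h (snd a) - h (fst a))"] .
  also have "\<dots> = sum f C + (\<Sum>a\<in>C. f (prod.swap a))"
    by (simp add: sign sum.distrib)
  also have "\<dots> = sum f C + sum f (prod.swap ` C)"
    by (simp add: sum.reindex)
  also have "\<dots> = sum f (parcs G)"
    unfolding C(1) using fin C(2) by (intro sum.union_disjoint[symmetric]) auto
  also have "\<dots> = (\<Sum>a\<in>set q. h (snd a) - h (fst a))"
    using q(1) pair_finite_arcs by (intro sum.mono_neutral_cong_right) (auto simp: f_def)
  also have "\<dots> = (\<Sum>(x, y)\<leftarrow>q. h y - h x)"
    using \<open>distinct q\<close> by (simp add: sum_list_distinct_conv_sum_set case_prod_unfold)
  also have "\<dots> = h u - h v"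
    by (rule pcas_sum_diff[OF q(2)])
  finally show ?thesis .
qed

text \<open>Missing vertices could be adjoined as isolated vertices to one side of the bipartition,
  contradicting maximality.\<close>

lemma pverts_max_bipartite_subgraph:
  assumes G: "pair_graph G" and max: "max_bipartite_subgraph G B"
  shows "pverts B = pverts G"
proof (rule ccontr)
  assume neq: "pverts B \<noteq> pverts G"
  interpret G: pair_graph G by fact
  have sub: "subgraph (with_proj B) (with_proj G)" and "bipartite_graph (with_proj B)"
    and nomax: "\<And>H. H \<noteq> with_proj B \<Longrightarrow> subgraph (with_proj B) H \<Longrightarrow>
      subgraph H (with_proj G) \<Longrightarrow> \<not> bipartite_graph H"
    using max by (auto simp: max_bipartite_subgraph_def pre_digraph.max_subgraph_def)
  then obtain Vp Vm where B: "graph (with_proj B)" and bip: "bipartition (with_proj B) Vp Vm"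
    by (auto simp: bipartite_graph_def)
  interpret B: pair_graph B using B by (rule pair_graphI_graph)
  have subs: "pverts B \<subseteq> pverts G" "parcs B \<subseteq> parcs G"
    using sub by (auto simp: subgraph_def)
  define H where "H = \<lparr> pverts = pverts G, parcs = parcs B \<rparr>"
  have "pair_graph H"
    using subs G.pair_finite_verts B.pair_finite_arcs B.no_loops B.sym_arcs
    by unfold_locales (auto simp: H_def symmetric_def dest: B.in_arcsD1 B.in_arcsD2)
  then interpret H: pair_graph H .
  have "bipartition (with_proj H) (Vp \<union> (pverts G - pverts B)) Vm"
    using bip subs(1) by (fastforce simp: bipartition_def H_def)
  then have "bipartite_graph (with_proj H)"
    unfolding bipartite_graph_def using H.graph_axioms by blast
  moreover have "subgraph (with_proj B) (with_proj H)" "subgraph (with_proj H) (with_proj G)"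
    unfolding subgraph_def
    using subs B.wf_digraph_axioms H.wf_digraph_axioms G.wf_digraph_axioms
    by (auto simp: H_def)
  moreover have "with_proj H \<noteq> with_proj B"
    using neq by (auto simp: H_def with_proj_def)
  ultimately show False
    using nomax by blast
qed

theorem mainTheorem6:
  fixes G B T :: "'v::finite pair_pre_digraph"
    and Vp Vm :: "'v set"
    and n :: nat
    and t :: "nat \<Rightarrow> 'v \<times> 'v"
    and c :: "'v set \<Rightarrow> nat \<Rightarrow> int"
  assumes "pair_graph G"
    and "pverts G = UNIV"
    and "Digraph_Component.connected (with_proj G)"
    and "uedges G \<noteq> {}"
    and "n = CARD('v) - 1"
    and "max_bipartite_subgraph G B"
    and "bipartition (with_proj B) Vp Vm"
    and "undirected_spanning_tree T B"
    and "bij_betw t {1..n} (canonical_orientation T Vp Vm)"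
    and "\<forall>e \<in> uedges G - uedges T. \<exists>p. oriented_fundamental_cycle T e p \<and>
           (\<forall>k \<in> {1..n}. c e k = traversal_sign p (t k))"
  shows "\<exists>f. bij_betw f
           {F. nabla_facet G F \<and> facet_graph F = B}
           {d \<in> {1..n} \<rightarrow>\<^sub>E {- 1, 1 :: int}.
              (\<forall>e \<in> uedges B - uedges T. (\<Sum>k = 1..n. c e k * d k) \<in> {- 1, 1}) \<and>
              (\<forall>e \<in> uedges G - uedges B. (\<Sum>k = 1..n. c e k * d k) = 0)}"
proof -
  interpret G: pair_graph G by fact
  have sub: "parcs B \<subseteq> parcs G" and "bipartite_graph (with_proj B)"
    using assms(6) by (auto simp: max_bipartite_subgraph_def pre_digraph.max_subgraph_def subgraph_def)
  then interpret B: pair_graph B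
    by (auto simp: bipartite_graph_def intro: pair_graphI_graph)
  have verts_B: "pverts B = UNIV"
    using pverts_max_bipartite_subgraph[OF assms(1,6)] assms(2) by simp
  have tree: "undirected_tree T" and span: "spanning (with_proj T) (with_proj B)"
    using assms(8) by (auto simp: undirected_spanning_tree_def)
  then interpret T: pair_graph T
    by (auto simp: undirected_tree_def)
  have conn_T: "Digraph_Component.connected (with_proj T)"
    using tree by (auto simp: undirected_tree_def)
  have verts_T: "pverts T = UNIV" and T_sub: "parcs T \<subseteq> parcs B"
    using span verts_B by (auto simp: spanning_def subgraph_def)
  \<comment> \<open>Connectedness of \<open>B\<close> is inherited from its spanning tree.\<close>
  have conn_B: "Digraph_Component.connected (with_proj B)"
    using B.connected_spanning_imp_connected[OF span conn_T] .
  \<comment> \<open>Without arcs, a connected \<open>B\<close> on all vertices has a single vertex,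
    but an edge of \<open>G\<close> joins two.\<close>
  have ne: "parcs B \<noteq> {}"
  proof
    assume "parcs B = {}"
    have "v = u" for u v :: 'v
      using conn_B UNIV_I[of u] UNIV_I[of v] unfolding verts_B[symmetric]
      by (induct rule: B.connected_propagate) (use \<open>parcs B = {}\<close> in auto)
    moreover obtain i j where "(i, j) \<in> parcs G"
      using assms(4) by (auto simp: uedges_def)
    ultimately show False
      using G.no_loops' by blast
  qed
  fix r :: 'v
  note facets = bij_betw_level_set[OF assms(1) B.pair_graph verts_B conn_B sub ne, of r]

  \<comment> \<open>The cut orientation of \<open>T\<close> and the difference map\<close>
  define C where "C = canonical_orientation T Vp Vm"
  have t: "bij_betw t {1..n} C"
    using assms(9) by (simp add: C_def)
  have cut: "u \<in> Vp \<and> v \<in> Vm \<or> u \<in> Vm \<and> v \<in> Vp" if "(u, v) \<in> parcs T" for u v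
    using assms(7) that T_sub by (auto simp: bipartition_def)
  have "Vp \<inter> Vm = {}"
    using assms(7) by (auto simp: bipartition_def)
  \<comment> \<open>Every tree edge crosses the cut, so one of its two arcs lies in
    \<open>C\<close>.\<close>
  have C: "parcs T = C \<union> prod.swap ` C"
  proof (intro equalityI subrelI)
    fix u v assume uv: "(u, v) \<in> parcs T"
    then have "(u, v) \<in> C \<or> (v, u) \<in> C"
      using cut[OF uv] T.arcs_symmetric[OF uv] by (auto simp: C_def canonical_orientation_def)
    then show "(u, v) \<in> C \<union> prod.swap ` C" by force
  qed (auto simp: C_def canonical_orientation_def intro: T.arcs_symmetric)
  have C_disj: "C \<inter> prod.swap ` C = {}"
    using \<open>Vp \<inter> Vm = {}\<close> by (auto simp: C_def canonical_orientation_def)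
  have T_arc: "\<exists>k \<in> {1..n}. (x, y) = t k \<or> (y, x) = t k" if "(x, y) \<in> parcs T" for x y
    using that t unfolding C bij_betw_def by force
  have t_arc: "t k \<in> parcs T" if "k \<in> {1..n}" for k
    using that t C by (auto simp: bij_betw_def)

  \<comment> \<open>Outside \<open>{1..n}\<close> the value must be \<open>undefined\<close> to
    match the extensional function space \<open>\<rightarrow>\<^sub>E\<close>.\<close>
  define D where "D h = restrict (\<lambda>k. h (snd (t k)) - h (fst (t k))) {1..n}" for h :: "'v \<Rightarrow> int"
  let ?S = "{d \<in> {1..n} \<rightarrow>\<^sub>E {- 1, 1 :: int}.
              (\<forall>e \<in> uedges B - uedges T. (\<Sum>k = 1..n. c e k * d k) \<in> {- 1, 1}) \<and>
              (\<forall>e \<in> uedges G - uedges B. (\<Sum>k = 1..n. c e k * d k) = 0)}"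
  \<comment> \<open>Stated for every \<open>h\<close>, since it serves both directions. The
    endpoints are existential because \<open>c\<close> fixes the orientation of the cycle, so the
    sign of the difference is not determined by \<open>e\<close>.\<close>
  have cycle_sum: "\<exists>u v. e = {u, v} \<and> (\<Sum>k = 1..n. c e k * D h k) = h u - h v"
    if e: "e \<in> uedges G - uedges T" for e h
  proof -
    obtain p where p: "oriented_fundamental_cycle T e p" "\<forall>k \<in> {1..n}. c e k = traversal_sign p (t k)"
      using assms(10) e by blast
    then obtain u v q where uvq: "e = {u, v}" "T.apath v q u" "p = (u, v) # q"
      by (auto simp: oriented_fundamental_cycle_def)
    have "(u, v) \<notin> parcs T"
      using e uvq(1) T.uedges_iff by auto
    from T.fundamental_cycle_sum[OF uvq(2) this C C_disj t, of h]
    have "(\<Sum>k = 1..n. c e k * D h k) = h u - h v"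
      using p(2) uvq(3) by (simp add: D_def)
    then show ?thesis using uvq(1) by blast
  qed

  \<comment> \<open>The bijection between potentials and sign vectors\<close>
  have "bij_betw D (potentials G B r) ?S"
  proof (rule bij_betwI')
    fix h h' assume h: "h \<in> potentials G B r" "h' \<in> potentials G B r"
    show "D h = D h' \<longleftrightarrow> h = h'"
    proof
      assume "D h = D h'"
      then have eq: "h (snd (t k)) - h (fst (t k)) = h' (snd (t k)) - h' (fst (t k))" if "k \<in> {1..n}" for k
        using that unfolding D_def by (metis (no_types, lifting) restrict_apply')
      have "h y - h x = h' y - h' x" if "(x, y) \<in> parcs T" for x y
        using T_arc[OF that] eq by (metis fst_conv snd_conv minus_diff_eq)
      moreover have "h r = h' r"
        using h by (simp add: potentials_def)
      ultimately have "h v = h' v" for v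
        using T.potential_determined[OF conn_T, of r v h h'] verts_T by auto
      then show "h = h'" by auto
    qed auto
  next
    fix h assume "h \<in> potentials G B r"
    then have hB: "\<And>i j. (i, j) \<in> parcs B \<Longrightarrow> \<bar>h i - h j\<bar> = 1"
      and hG: "\<And>i j. (i, j) \<in> parcs G - parcs B \<Longrightarrow> h i = h j"
      by (auto simp: potentials_def)
    have "D h k \<in> {- 1, 1}" if "k \<in> {1..n}" for k
      using hB[of "fst (t k)" "snd (t k)"] t_arc[OF that] T_sub that by (auto simp: D_def abs_if split: if_splits)
    then have "D h \<in> {1..n} \<rightarrow>\<^sub>E {- 1, 1}"
      by (auto simp: D_def)
    moreover have "(\<Sum>k = 1..n. c e k * D h k) \<in> {- 1, 1}" if e: "e \<in> uedges B - uedges T" for e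
    proof -
      have "e \<in> uedges G - uedges T"
        using e sub by (auto simp: uedges_def)
      then obtain u v where uv: "e = {u, v}" "(\<Sum>k = 1..n. c e k * D h k) = h u - h v"
        using cycle_sum by blast
      then have "\<bar>h u - h v\<bar> = 1"
        using hB e B.uedges_iff by auto
      then show ?thesis
        unfolding uv(2) by auto
    qed
    moreover have "(\<Sum>k = 1..n. c e k * D h k) = 0" if e: "e \<in> uedges G - uedges B" for e
    proof -
      have "e \<in> uedges G - uedges T"
        using e T_sub by (auto simp: uedges_def)
      then obtain u v where uv: "e = {u, v}" "(\<Sum>k = 1..n. c e k * D h k) = h u - h v"
        using cycle_sum by blast
      then have "h u = h v"
        using hG e B.uedges_iff G.uedges_iff by auto
      then show ?thesis
        unfolding uv(2) by auto
    qed
    ultimately show "D h \<in> ?S" by blast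
  next
    fix d assume d: "d \<in> ?S"
    \<comment> \<open>Extends \<open>d\<close> antisymmetrically from \<open>C\<close> to all arcs
      of \<open>T\<close>, as \<open>tree_potential_exists\<close> requires.\<close>
    define w where "w a = (if a \<in> C then d (inv_into {1..n} t a)
      else - d (inv_into {1..n} t (prod.swap a)))" for a
    have "w (y, x) = - w (x, y)" if "(x, y) \<in> parcs T" for x y
      using that C C_disj by (auto simp: w_def)
    then obtain h where h: "h r = 0" "\<And>x y. (x, y) \<in> parcs T \<Longrightarrow> h y - h x = w (x, y)"
      using T.tree_potential_exists[OF tree, of r w] verts_T by blast
    have ht: "h (snd (t k)) - h (fst (t k)) = d k" if k: "k \<in> {1..n}" for k
    proof -
      have "w (t k) = d k"
        using t k by (auto simp: w_def bij_betw_def)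
      then show ?thesis
        using h(2)[of "fst (t k)" "snd (t k)"] t_arc[OF k] by simp
    qed
    have D_h: "D h = d"
    proof
      fix k
      have "d \<in> {1..n} \<rightarrow>\<^sub>E {- 1, 1}"
        using d by blast
      then show "D h k = d k"
        using ht PiE_arb[of d "{1..n}" _ k] by (cases "k \<in> {1..n}") (simp_all add: D_def)
    qed
    have "\<bar>h i - h j\<bar> = 1" if ij: "(i, j) \<in> parcs B" for i j
    proof (cases "(i, j) \<in> parcs T")
      case True
      then obtain k where k: "k \<in> {1..n}" "(i, j) = t k \<or> (j, i) = t k"
        using T_arc by blast
      have "d k \<in> {- 1, 1}"
        using d k(1) by blast
      moreover have "h j - h i = d k \<or> h i - h j = d k"
        using ht[OF k(1)] k(2) by (metis fst_conv snd_conv)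
      ultimately show ?thesis by auto
    next
      case False
      then have e: "{i, j} \<in> uedges B - uedges T" "{i, j} \<in> uedges G - uedges T"
        using ij sub by (auto simp: B.uedges_iff T.uedges_iff G.uedges_iff)
      obtain u v where "{i, j} = {u, v}" "(\<Sum>k = 1..n. c {i, j} k * d k) = h u - h v"
        using cycle_sum[OF e(2), of h] D_h by auto
      moreover have "(\<Sum>k = 1..n. c {i, j} k * d k) \<in> {- 1, 1}"
        using d e(1) by blast
      ultimately show ?thesis by (auto simp: doubleton_eq_iff)
    qed
    moreover have "h i = h j" if ij: "(i, j) \<in> parcs G - parcs B" for i j
    proof -
      have e: "{i, j} \<in> uedges G - uedges B" "{i, j} \<in> uedges G - uedges T"
        using ij T_sub by (auto simp: B.uedges_iff T.uedges_iff G.uedges_iff)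
      obtain u v where "{i, j} = {u, v}" "(\<Sum>k = 1..n. c {i, j} k * d k) = h u - h v"
        using cycle_sum[OF e(2), of h] D_h by auto
      moreover have "(\<Sum>k = 1..n. c {i, j} k * d k) = 0"
        using d e(1) by blast
      ultimately show ?thesis by (auto simp: doubleton_eq_iff)
    qed
    ultimately have "h \<in> potentials G B r"
      using h(1) by (auto simp: potentials_def)
    then show "\<exists>h \<in> potentials G B r. d = D h"
      using D_h by blast
  qed
  \<comment> \<open>From facets back to potentials by the inverse of \<open>level_set G\<close>,
    then on to sign vectors by \<open>D\<close>.\<close>
  then show ?thesis
    using bij_betw_trans[OF bij_betw_inv_into[OF facets]] by blast
qed

end
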